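(* Let $\mathbb X$ be a Banach space over $\mathbb K=\mathbb R$ or $\mathbb C$ and let $\{\mathbf e_n,\mathbf e_n^*\}_{n=1}^\infty$ be a semi-normalized biorthogonal system in $\mathbb X\times\mathbb X^*$ whose vectors $\mathbf e_n$ have dense span (as in the context). Then for all $N\ge 1$ $$\mathbf L_N\ \ge\ \max\{k_N^c,\ \widetilde{\mathbf L}_N\}\qquad\text{and}\qquad \widetilde{\mathbf L}_N\ \ge\ \max\Big\{g_N^c,\ \nu_N,\ \mu_N,\ \tfrac1{2\kappa}\tilde\mu_N\Big\},$$ where $\kappa=1$ if $\mathbb K=\mathbb R$ and $\kappa=2$ if $\mathbb K=\mathbb C$.
   Context: Setting: $\mathbb X$ is a Banach space over $\mathbb K=\mathbb R$ or $\mathbb C$; $\{\mathbf e_n,\mathbf e_n^*\}_{n=1}^\infty\subset\mathbb X\times\mathbb X^*$ satisfies $\mathbf e_m^*(\mathbf e_n)=\delta_{m,n}$; $\mathscr B=\{\mathbf e_n\}$ has dense linear span in $\mathbb X$; and $0<\kappa_1\le\|\mathbf e_n\|,\|\mathbf e_n^*\|\le\kappa_2<\infty$ for all $n$. (Then $\lim_n\mathbf e_n^*(x)=0$ for all $x\in\mathbb X$.) Projections: for finite $A\subset\mathbb N$, $P_Ax=\sum_{n\in A}\mathbf e_n^*(x)\mathbf e_n$. Greedy sets: a finite set $\Gamma\subset\mathbb N$ is a greedy set for $x$ if $\min_{n\in\Gamma}|\mathbf e_n^*(x)|\ge\max_{n\in\Gamma^c}|\mathbf e_n^*(x)|$; $\mathscr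 G(x,N)$ is the collection of greedy sets for $x$ of cardinality $N$. $\mathscr G_N$ is the set of all maps $G:\mathbb X\to\mathbb X$ with $Gx=P_{\Gamma_x}x$ for some choice $\Gamma_x\in\mathscr G(x,N)$, for each $x$. Approximation errors: $\Sigma_N=\{\sum_{n\in A}a_n\mathbf e_n: |A|\le N,\ a_n\in\mathbb K\}$, $\sigma_N(x)=\operatorname{dist}(x,\Sigma_N)$, $\widetilde\sigma_N(x)=\inf\{\|x-P_Ax\|: |A|\le N\}$. Lebesgue constants: $\mathbf L_N$ (resp. $\widetilde{\mathbf L}_N$) is the smallest number such that $\|x-Gx\|\le\mathbf L_N\sigma_N(x)$ (resp. $\|x-Gx\|\le\widetilde{\mathbf L}_N\widetilde\sigma_N(x)$) for all $x\in\mathbb X$ and all $G\in\mathscr G_N$. Other constants: $k_N^c=\sup_{|A|\le N}\|I-P_A\|$; $g_N^c=\sup\{\|x-P_\Gamma x\|/\|x\|: x\ne0,\ \Gamma\in\mathscr G(x,k),\ 1\le k\le N\}$. $\Upsilon$ is the set of sequences $\boldsymbol\varepsilon=\{\varepsilon_n\}$ in $\mathbb K$ with $|\varepsilon_n|=1$ for all $n$; $\mathbf 1_A=\sum_{n\in A}\mathbf e_n$, $\mathbf 1_{\boldsymbol\varepsilon A}=\sum_{n\in A}\varepsilon_n\mathbf e_n$. $\mu_N=\sup_{|A|=|B|\le N}\|\mathbf 1_A\|/\|\mathbf 1_B\|$, $\ \tilde\mu_N=\sup\{\|\mathbf 1_{\boldsymbol\varepsilon A}\|/\|\mathbf 1_{\boldsymbol\eta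 B}\|: |A|=|B|\le N,\ \boldsymbol\varepsilon,\boldsymbol\eta\in\Upsilon\}$ (nonempty finite sets). $\nu_N$ is the supremum of $\|\mathbf 1_{\boldsymbol\varepsilon A}+x\|/\|\mathbf 1_{\boldsymbol\eta B}+x\|$ over all $|A|=|B|\le N$ (nonempty), $\boldsymbol\varepsilon,\boldsymbol\eta\in\Upsilon$, and $x\in\mathbb X$ with $|x|_\infty:=\sup_n|\mathbf e_n^*(x)|\le1$ such that $A$, $B$ and $\operatorname{supp}x=\{n:\mathbf e_n^*(x)\ne0\}$ are pairwise disjoint. *)

theory Defs
  imports "HOL-Analysis.Analysis"
begin

text \<open>
  A Banach space over a scalar field \<open>'k\<close>, used below with \<open>'k = real\<close> and \<open>'k = complex\<close>. The
  library only provides real Banach spaces (class \<open>banach\<close>), so the \<open>'k\<close>-structure is given by a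
  scalar multiplication which extends \<open>scaleR\<close> and for which the norm is homogeneous. For
  \<open>'k = real\<close> these conditions force \<open>smul = scaleR\<close>.
\<close>

locale banach_space_over = vector_space smul
  for smul :: "'k::real_normed_field \<Rightarrow> 'a::banach \<Rightarrow> 'a" +
  assumes scale_of_real: "smul (of_real r) x = r *\<^sub>R x"
    and norm_scale: "norm (smul c x) = norm c * norm x"

text \<open>
  Sequences are indexed from 0. For a \<open>'k\<close>-linear functional, \<open>bounded_linear\<close> (a notion over the
  reals) adds exactly boundedness, and \<open>onorm\<close> is its norm in the dual space.
\<close>

locale seminormalized_biorthogonal_system = banach_space_over smul
  for smul :: "'k::real_normed_field \<Rightarrow> 'a::banach \<Rightarrow> 'a" +
  fixes e :: "nat \<Rightarrow> 'a"
    and es :: "nat \<Rightarrow> 'a \<Rightarrow> 'k"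
  assumes functional_linear: "Vector_Spaces.linear smul (*) (es n)"
    and functional_bounded: "bounded_linear (es n)"
    and biorthogonal: "es m (e n) = (if m = n then 1 else 0)"
    and dense_span: "closure (module.span smul (range e)) = UNIV"
    and seminormalized: "\<exists>\<kappa>\<^sub>1 \<kappa>\<^sub>2. 0 < \<kappa>\<^sub>1 \<and>
      (\<forall>n. \<kappa>\<^sub>1 \<le> norm (e n) \<and> norm (e n) \<le> \<kappa>\<^sub>2 \<and>
           \<kappa>\<^sub>1 \<le> onorm (es n) \<and> onorm (es n) \<le> \<kappa>\<^sub>2)"

definition coord_proj ::
    "('k \<Rightarrow> 'a \<Rightarrow> 'a) \<Rightarrow> (nat \<Rightarrow> 'a) \<Rightarrow> (nat \<Rightarrow> 'a \<Rightarrow> 'k) \<Rightarrow> nat set \<Rightarrow> 'a::comm_monoid_add \<Rightarrow> 'a"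
  where "coord_proj smul e es A x = (\<Sum>n\<in>A. smul (es n x) (e n))"

definition greedy_sets :: "(nat \<Rightarrow> 'a \<Rightarrow> 'k::real_normed_field) \<Rightarrow> 'a \<Rightarrow> nat \<Rightarrow> nat set set"
  where "greedy_sets es x N =
    {\<Gamma>. finite \<Gamma> \<and> card \<Gamma> = N \<and> (\<forall>m\<in>\<Gamma>. \<forall>n\<in>-\<Gamma>. norm (es n x) \<le> norm (es m x))}"

definition greedy_ops ::
    "('k::real_normed_field \<Rightarrow> 'a \<Rightarrow> 'a) \<Rightarrow> (nat \<Rightarrow> 'a) \<Rightarrow> (nat \<Rightarrow> 'a \<Rightarrow> 'k) \<Rightarrow> nat \<Rightarrow> ('a::banach \<Rightarrow> 'a) set"
  where "greedy_ops smul e es N =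
    {G. \<forall>x. \<exists>\<Gamma>\<in>greedy_sets es x N. G x = coord_proj smul e es \<Gamma> x}"

definition sparse_vectors :: "('k \<Rightarrow> 'a \<Rightarrow> 'a) \<Rightarrow> (nat \<Rightarrow> 'a) \<Rightarrow> nat \<Rightarrow> 'a::banach set"
  where "sparse_vectors smul e N =
    {\<Sum>n\<in>A. smul (a n) (e n) | A a. finite A \<and> card A \<le> N}"

definition sigma :: "('k \<Rightarrow> 'a \<Rightarrow> 'a) \<Rightarrow> (nat \<Rightarrow> 'a) \<Rightarrow> nat \<Rightarrow> 'a::banach \<Rightarrow> real"
  where "sigma smul e N x = infdist x (sparse_vectors smul e N)"

definition sigma_tilde ::
    "('k \<Rightarrow> 'a \<Rightarrow> 'a) \<Rightarrow> (nat \<Rightarrow> 'a) \<Rightarrow> (nat \<Rightarrow> 'a \<Rightarrow> 'k) \<Rightarrow> nat \<Rightarrow> 'a::banach \<Rightarrow> real"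
  where "sigma_tilde smul e es N x =
    Inf {norm (x - coord_proj smul e es A x) | A. finite A \<and> card A \<le> N}"

text \<open>
  The constants below are extended reals, so that the infima and suprema always exist.
\<close>

definition lebesgue_const ::
    "('k::real_normed_field \<Rightarrow> 'a \<Rightarrow> 'a) \<Rightarrow> (nat \<Rightarrow> 'a::banach) \<Rightarrow> (nat \<Rightarrow> 'a \<Rightarrow> 'k) \<Rightarrow> nat \<Rightarrow> ereal"
  where "lebesgue_const smul e es N =
    Inf {ereal C | C. \<forall>x. \<forall>G\<in>greedy_ops smul e es N. norm (x - G x) \<le> C * sigma smul e N x}"

definition lebesgue_const_tilde ::
    "('k::real_normed_field \<Rightarrow> 'a \<Rightarrow> 'a) \<Rightarrow> (nat \<Rightarrow> 'a::banach) \<Rightarrow> (nat \<Rightarrow> 'a \<Rightarrow> 'k) \<Rightarrow> nat \<Rightarrow> ereal"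
  where "lebesgue_const_tilde smul e es N =
    Inf {ereal C | C. \<forall>x. \<forall>G\<in>greedy_ops smul e es N. norm (x - G x) \<le> C * sigma_tilde smul e es N x}"

definition k_compl ::
    "('k::real_normed_field \<Rightarrow> 'a \<Rightarrow> 'a) \<Rightarrow> (nat \<Rightarrow> 'a::banach) \<Rightarrow> (nat \<Rightarrow> 'a \<Rightarrow> 'k) \<Rightarrow> nat \<Rightarrow> ereal"
  where "k_compl smul e es N =
    Sup {ereal (onorm (\<lambda>x. x - coord_proj smul e es A x)) | A. finite A \<and> card A \<le> N}"

definition g_compl ::
    "('k::real_normed_field \<Rightarrow> 'a \<Rightarrow> 'a) \<Rightarrow> (nat \<Rightarrow> 'a::banach) \<Rightarrow> (nat \<Rightarrow> 'a \<Rightarrow> 'k) \<Rightarrow> nat \<Rightarrow> ereal"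
  where "g_compl smul e es N =
    Sup {ereal (norm (x - coord_proj smul e es \<Gamma> x) / norm x) | x \<Gamma> k.
      x \<noteq> 0 \<and> \<Gamma> \<in> greedy_sets es x k \<and> 1 \<le> k \<and> k \<le> N}"

definition unimodular :: "(nat \<Rightarrow> 'k::real_normed_field) set"
  where "unimodular = {\<epsilon>. \<forall>n. norm (\<epsilon> n) = 1}"

definition ind_sum :: "(nat \<Rightarrow> 'a) \<Rightarrow> nat set \<Rightarrow> 'a::banach"
  where "ind_sum e A = (\<Sum>n\<in>A. e n)"

definition signed_sum :: "('k \<Rightarrow> 'a \<Rightarrow> 'a) \<Rightarrow> (nat \<Rightarrow> 'a) \<Rightarrow> (nat \<Rightarrow> 'k) \<Rightarrow> nat set \<Rightarrow> 'a::banach"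
  where "signed_sum smul e \<epsilon> A = (\<Sum>n\<in>A. smul (\<epsilon> n) (e n))"

definition same_size_pair :: "nat \<Rightarrow> nat set \<Rightarrow> nat set \<Rightarrow> bool"
  where "same_size_pair N A B \<longleftrightarrow>
    finite A \<and> finite B \<and> A \<noteq> {} \<and> B \<noteq> {} \<and> card A = card B \<and> card B \<le> N"

definition mu :: "(nat \<Rightarrow> 'a::banach) \<Rightarrow> nat \<Rightarrow> ereal"
  where "mu e N =
    Sup {ereal (norm (ind_sum e A) / norm (ind_sum e B)) | A B. same_size_pair N A B}"

definition mu_tilde ::
    "('k::real_normed_field \<Rightarrow> 'a \<Rightarrow> 'a) \<Rightarrow> (nat \<Rightarrow> 'a::banach) \<Rightarrow> nat \<Rightarrow> ereal"
  where "mu_tilde smul e N =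
    Sup {ereal (norm (signed_sum smul e \<epsilon> A) / norm (signed_sum smul e \<eta> B)) | A B \<epsilon> \<eta>.
      same_size_pair N A B \<and> \<epsilon> \<in> unimodular \<and> \<eta> \<in> unimodular}"

definition supp :: "(nat \<Rightarrow> 'a \<Rightarrow> 'k::real_normed_field) \<Rightarrow> 'a \<Rightarrow> nat set"
  where "supp es x = {n. es n x \<noteq> 0}"

text \<open>
  A real supremum: in a semi-normalized system the coefficients of each vector are bounded.
\<close>

definition coeff_sup_norm :: "(nat \<Rightarrow> 'a \<Rightarrow> 'k::real_normed_field) \<Rightarrow> 'a \<Rightarrow> real"
  where "coeff_sup_norm es x = (SUP n. norm (es n x))"

definition nu ::
    "('k::real_normed_field \<Rightarrow> 'a \<Rightarrow> 'a) \<Rightarrow> (nat \<Rightarrow> 'a::banach) \<Rightarrow> (nat \<Rightarrow> 'a \<Rightarrow> 'k) \<Rightarrow> nat \<Rightarrow> ereal"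
  where "nu smul e es N =
    Sup {ereal (norm (signed_sum smul e \<epsilon> A + x) / norm (signed_sum smul e \<eta> B + x)) | A B \<epsilon> \<eta> x.
      same_size_pair N A B \<and> \<epsilon> \<in> unimodular \<and> \<eta> \<in> unimodular \<and>
      coeff_sup_norm es x \<le> 1 \<and>
      A \<inter> B = {} \<and> A \<inter> supp es x = {} \<and> B \<inter> supp es x = {}}"

end

theory Submission
  imports Defs
begin

text \<open>
  Everything reduces to one inequality: if \<open>C\<close> is admissible for \<open>lebesgue_const_tilde\<close> at \<open>N\<close>, and
  \<open>\<Gamma>\<close> is a greedy set for \<open>w\<close> with \<open>card A \<le> card \<Gamma> \<le> N\<close>, then
  \<open>\<parallel>w - P\<^sub>\<Gamma> w\<parallel> \<le> C \<parallel>w - P\<^sub>A w\<parallel>\<close>. When \<open>card \<Gamma> < N\<close>, one overwrites the coefficients of \<open>w\<close> on a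
  block of \<open>N - card \<Gamma>\<close> far-out indices by a threshold of \<open>\<Gamma>\<close>, so that \<open>\<Gamma>\<close> together with the block
  is greedy; the error made vanishes as the block moves to infinity, since coefficients tend to 0.
  Suitable choices of \<open>w\<close> bound \<open>g\<^sup>c\<close>, \<open>\<nu>\<close> and \<open>\<mu>\<close>. For unimodular signs \<open>\<epsilon>\<close> and \<open>\<eta>\<close>, the ratio \<open>\<epsilon>/\<eta>\<close>
  on \<open>A \<inter> B\<close> is split into positive and negative (real and imaginary) parts, which are convex
  combinations of indicators of subsets of \<open>A \<inter> B\<close>; this gives the factor \<open>2\<kappa>\<close>.
\<close>

section \<open>Convexity and counting preliminaries\<close>

text \<open>By induction on \<open>S\<close>: the vector is a convex combination, with weight
  \<open>a s\<close>, of the two vectors whose coefficient at \<open>u s\<close> is 0 or 1, and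
  balls are convex. The vector \<open>v\<close> is generalised because the second of them has base
  point \<open>v + u s\<close>.\<close>

lemma norm_add_sum_scaled_le:
  fixes u :: "'i \<Rightarrow> 'a::real_normed_vector"
  assumes "finite S"
    and "\<And>n. n \<in> S \<Longrightarrow> 0 \<le> a n \<and> a n \<le> 1"
    and "\<And>T. T \<subseteq> S \<Longrightarrow> norm (v + sum u T) \<le> M"
  shows "norm (v + (\<Sum>n\<in>S. a n *\<^sub>R u n)) \<le> M"
  using assms
proof (induction S arbitrary: v rule: finite_induct)
  case empty
  then show ?case by force
next
  case (insert s S)
  let ?t = "\<Sum>n\<in>S. a n *\<^sub>R u n"
  have 1: "norm (v + ?t) \<le> M"
    using insert.prems by (intro insert.IH) auto
  have 2: "norm ((v + u s) + ?t) \<le> M"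
  proof (intro insert.IH)
    fix T assume T: "T \<subseteq> S"
    then have "finite T" "s \<notin> T"
      using insert.hyps by (auto intro: finite_subset)
    then have "v + u s + sum u T = v + sum u (insert s T)"
      by (simp add: add.assoc)
    moreover have "insert s T \<subseteq> insert s S" using T by auto
    ultimately show "norm (v + u s + sum u T) \<le> M"
      using insert.prems(2) by metis
  qed (use insert.prems in auto)
  have as: "0 \<le> a s" "a s \<le> 1" using insert.prems(1)[of s] by auto
  have "v + (\<Sum>n\<in>insert s S. a n *\<^sub>R u n) = (1 - a s) *\<^sub>R (v + ?t) + a s *\<^sub>R ((v + u s) + ?t)"
    using insert.hyps by (simp add: algebra_simps)
  moreover have "\<dots> \<in> cball 0 M"
    using 1 2 as by (intro convexD_alt[OF convex_cball]) auto
  ultimately show ?case by simp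
qed

text \<open>For \<open>b = 0\<close> the quotient is 0 by convention, and then
  \<open>0 \<le> c\<close> gives the bound.\<close>

lemma divide_le_of_le_mult: "a \<le> c * b \<Longrightarrow> 0 \<le> c \<Longrightarrow> 0 \<le> b \<Longrightarrow> a / b \<le> (c::real)"
  by (cases "b = 0") (auto simp: divide_le_eq)

lemma card_Diff_eq_of_same_size:
  assumes "same_size_pair N A B"
  shows "card (A - B) = card (B - A)"
proof -
  have "card A = card (A - B) + card (A \<inter> B)" "card B = card (B - A) + card (A \<inter> B)"
    using assms card_Int_Diff[of A B] card_Int_Diff[of B A]
    by (auto simp: same_size_pair_def Int_commute)
  with assms show ?thesis by (simp add: same_size_pair_def)
qed

section \<open>Coefficients, finite combinations and projections\<close>

context seminormalized_biorthogonal_system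
begin

abbreviation P where "P \<equiv> coord_proj smul e es"
abbreviation lcomb where "lcomb \<equiv> signed_sum smul e"

lemma es_simps [simp]:
  "es n (x + y) = es n x + es n y" "es n (x - y) = es n x - es n y"
  "es n 0 = 0" "es n (sum f A) = (\<Sum>i\<in>A. es n (f i))"
  "es n (smul c x) = c * es n x"
proof -
  interpret b: bounded_linear "es n" by (rule functional_bounded)
  show "es n (x + y) = es n x + es n y" "es n (x - y) = es n x - es n y" "es n 0 = 0"
    "es n (sum f A) = (\<Sum>i\<in>A. es n (f i))"
    by (simp_all add: b.add b.diff b.zero b.sum)
  show "es n (smul c x) = c * es n x"
    using functional_linear[of n] by (simp add: Vector_Spaces.linear_iff)
qed

lemma es_lcomb [simp]: "finite A \<Longrightarrow> es n (lcomb a A) = (if n \<in> A then a n else 0)"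
  by (simp add: signed_sum_def biorthogonal if_distrib[of "(*) _"] cong: if_cong)

lemma coord_proj_eq_lcomb: "P A x = lcomb (\<lambda>n. es n x) A"
  by (simp add: coord_proj_def signed_sum_def)

lemma lcomb_cong: "(\<And>n. n \<in> A \<Longrightarrow> a n = b n) \<Longrightarrow> lcomb a A = lcomb b A"
  by (simp add: signed_sum_def)

lemma lcomb_empty [simp]: "lcomb a {} = 0"
  by (simp add: signed_sum_def)

lemma lcomb_Un: "finite A \<Longrightarrow> finite B \<Longrightarrow> A \<inter> B = {} \<Longrightarrow> lcomb a (A \<union> B) = lcomb a A + lcomb a B"
  by (simp add: signed_sum_def sum.union_disjoint)

lemma lcomb_split:
  assumes "same_size_pair N A B"
  shows "lcomb \<epsilon> A = lcomb \<epsilon> (A - B) + lcomb \<epsilon> (A \<inter> B)"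
proof -
  have "lcomb \<epsilon> ((A - B) \<union> (A \<inter> B)) = lcomb \<epsilon> (A - B) + lcomb \<epsilon> (A \<inter> B)"
    using assms by (intro lcomb_Un) (auto simp: same_size_pair_def)
  then show ?thesis by (simp add: Un_Diff_Int)
qed

lemma ind_sum_eq_lcomb: "ind_sum e A = lcomb (\<lambda>_. 1) A"
  by (simp add: signed_sum_def ind_sum_def)

lemma es_coord_proj [simp]: "finite A \<Longrightarrow> es n (P A x) = (if n \<in> A then es n x else 0)"
  by (simp add: coord_proj_eq_lcomb)

lemma coord_proj_Un: "finite A \<Longrightarrow> finite B \<Longrightarrow> A \<inter> B = {} \<Longrightarrow> P (A \<union> B) x = P A x + P B x"
  by (simp add: coord_proj_eq_lcomb lcomb_Un)

section \<open>Boundedness and decay of coefficients\<close>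

lemma ex_coeff_bound: "\<exists>K>0. \<forall>n x. norm (es n x) \<le> K * norm x"
proof -
  obtain k1 K where K: "0 < k1" "\<And>n. k1 \<le> onorm (es n)" "\<And>n. onorm (es n) \<le> K"
    using seminormalized by blast
  have "norm (es n x) \<le> K * norm x" for n x
    using onorm[OF functional_bounded, of n x] mult_right_mono[OF K(3)[of n], of "norm x"] by simp
  moreover have "K > 0" using K(1) K(2,3)[of 0] by linarith
  ultimately show ?thesis by blast
qed

lemma ex_coeff_upper: "\<exists>\<alpha>\<ge>0. \<forall>n. norm (es n x) \<le> \<alpha>"
proof -
  obtain K where "K > 0" "\<And>n x. norm (es n x) \<le> K * norm x" using ex_coeff_bound by blast
  then show ?thesis by (intro exI[of _ "K * norm x"]) auto
qed

lemma coeff_le_of_sup_norm_le: "coeff_sup_norm es x \<le> c \<Longrightarrow> norm (es n x) \<le> c"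
proof -
  assume c: "coeff_sup_norm es x \<le> c"
  have "bdd_above (range (\<lambda>n. norm (es n x)))"
    using ex_coeff_upper[of x] unfolding bdd_above_def by blast
  then have "norm (es n x) \<le> coeff_sup_norm es x"
    unfolding coeff_sup_norm_def by (rule cSUP_upper[OF UNIV_I])
  with c show ?thesis by simp
qed

text \<open>A vector of the span involves only finitely many \<open>e k\<close>, and biorthogonality
  kills its other coefficients.\<close>

lemma eventually_es_eq_0:
  assumes "y \<in> span (range e)"
  shows "\<forall>\<^sub>F n in sequentially. es n y = 0"
  using assms
proof (induction rule: span_induct_alt)
  case base
  then show ?case by simp
next
  case (step c x y)
  then obtain k where k: "x = e k" by auto
  from step.IH eventually_gt_at_top[of k] show ?case
    by eventually_elim (simp add: k biorthogonal)
qed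

text \<open>Density of the span gives a nearby \<open>y\<close> whose coefficients eventually
  vanish; the uniform bound on the functionals controls the coefficients of
  \<open>x - y\<close>.\<close>

lemma es_tendsto_0: "(\<lambda>n. es n x) \<longlonglongrightarrow> 0"
proof (rule LIMSEQ_I)
  fix r :: real assume r: "r > 0"
  obtain K where K: "K > 0" "\<And>n x. norm (es n x) \<le> K * norm x" using ex_coeff_bound by blast
  have "x \<in> closure (span (range e))" using dense_span by simp
  then obtain y where y: "y \<in> span (range e)" "dist y x < r / K"
    using r K(1) by (meson closure_approachable divide_pos_pos)
  obtain n0 where n0: "\<And>n. n \<ge> n0 \<Longrightarrow> es n y = 0"
    using eventually_es_eq_0[OF y(1)] by (auto simp: eventually_sequentially)
  have "norm (es n x - 0) < r" if "n \<ge> n0" for n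
  proof -
    have "norm (es n x) = norm (es n (x - y))" using n0[OF that] by simp
    also have "\<dots> \<le> K * norm (x - y)" by (rule K(2))
    also have "\<dots> < r" using y(2) K(1) by (simp add: dist_norm norm_minus_commute field_simps)
    finally show ?thesis by simp
  qed
  then show "\<exists>n0. \<forall>n\<ge>n0. norm (es n x - 0) < r" by blast
qed

text \<open>The length \<open>j\<close> of the block is fixed, so this is a sum of \<open>j\<close>
  null sequences. Hence an auxiliary block pushed to infinity leaves no trace in the limit.\<close>

lemma coord_proj_block_tendsto_0: "(\<lambda>m. P {m..<m+j} x) \<longlonglongrightarrow> 0"
proof -
  obtain k2 where k2: "\<And>n. norm (e n) \<le> k2"
    using seminormalized by blast
  have "(\<lambda>n. smul (es n x) (e n)) \<longlonglongrightarrow> 0"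
  proof (rule Lim_null_comparison)
    show "\<forall>\<^sub>F n in sequentially. norm (smul (es n x) (e n)) \<le> norm (es n x) * k2"
      using k2 by (auto simp: norm_scale intro!: always_eventually mult_left_mono)
    show "(\<lambda>n. norm (es n x) * k2) \<longlonglongrightarrow> 0"
      using tendsto_mult[OF tendsto_norm[OF es_tendsto_0[of x]] tendsto_const[of k2]] by simp
  qed
  then have "(\<lambda>m. smul (es (i + m) x) (e (i + m))) \<longlonglongrightarrow> 0" for i
    using LIMSEQ_ignore_initial_segment[of _ 0 i] by (simp add: add.commute[of i])
  then have "(\<lambda>m. \<Sum>i<j. smul (es (i + m) x) (e (i + m))) \<longlonglongrightarrow> (\<Sum>i<j. 0)"
    by (rule tendsto_sum)
  moreover have "P {m..<m+j} x = (\<Sum>i<j. smul (es (i + m) x) (e (i + m)))" for m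
    unfolding coord_proj_def
    using sum.shift_bounds_nat_ivl[of "\<lambda>n. smul (es n x) (e n)" 0 m j]
    by (simp add: atLeast0LessThan add.commute)
  ultimately show ?thesis by simp
qed

section \<open>Existence of greedy sets and greedy operators\<close>

text \<open>A greedy set is enlarged by an index of largest coefficient outside it. Such an index
  exists: coefficients tend to 0, so only finitely many are at least as large as a given nonzero
  one.\<close>

lemma ex_greedy_set: "\<exists>\<Gamma>. \<Gamma> \<in> greedy_sets es x N"
proof (induction N)
  case 0
  show ?case by (rule exI[of _ "{}"]) (simp add: greedy_sets_def)
next
  case (Suc N)
  then obtain \<Gamma> where \<Gamma>: "finite \<Gamma>" "card \<Gamma> = N" "\<And>m n. m \<in> \<Gamma> \<Longrightarrow> n \<notin> \<Gamma> \<Longrightarrow> norm (es n x) \<le> norm (es m x)"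
    by (auto simp: greedy_sets_def)
  obtain m where m: "m \<notin> \<Gamma>" "\<And>n. n \<notin> \<Gamma> \<Longrightarrow> norm (es n x) \<le> norm (es m x)"
  proof (cases "\<forall>n. n \<notin> \<Gamma> \<longrightarrow> es n x = 0")
    case True
    obtain m where "m \<notin> \<Gamma>" using ex_new_if_finite[OF infinite_UNIV_nat \<Gamma>(1)] by blast
    with True show ?thesis by (intro that[of m]) auto
  next
    case False
    then obtain n0 where n0: "n0 \<notin> \<Gamma>" "norm (es n0 x) > 0" by auto
    define S where "S = {n. n \<notin> \<Gamma> \<and> norm (es n x) \<ge> norm (es n0 x)}"
    have "\<forall>\<^sub>F n in sequentially. norm (es n x) < norm (es n0 x)"
      using order_tendstoD(2)[OF tendsto_norm_zero[OF es_tendsto_0] n0(2)] .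
    then obtain M where M: "\<And>n. n \<ge> M \<Longrightarrow> norm (es n x) < norm (es n0 x)"
      by (auto simp: eventually_sequentially)
    have "S \<subseteq> {..<M}" using M unfolding S_def by (auto simp flip: not_le)
    then have "finite S" using finite_subset by blast
    moreover have "n0 \<in> S" using n0 by (simp add: S_def)
    ultimately obtain m where m: "m \<in> S" "\<And>n. n \<in> S \<Longrightarrow> norm (es n x) \<le> norm (es m x)"
      using ex_is_arg_min_if_finite[of S "\<lambda>n. - norm (es n x)"]
      by (auto simp: is_arg_min_linorder)
    have "norm (es n x) \<le> norm (es m x)" if "n \<notin> \<Gamma>" for n
      using m(2)[of n] m(1) that by (cases "n \<in> S") (auto simp: S_def)
    with m(1) show ?thesis by (intro that[of m]) (auto simp: S_def)
  qed
  have "insert m \<Gamma> \<in> greedy_sets es x (Suc N)"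
    using \<Gamma> m by (auto simp: greedy_sets_def)
  then show ?case by blast
qed

text \<open>A greedy operator chooses its set at each vector independently, so the choice at
  \<open>y\<close> can be prescribed. This turns bounds on all greedy operators into bounds on all
  greedy sets.\<close>

lemma ex_greedy_op:
  assumes "\<Gamma> \<in> greedy_sets es y N"
  shows "\<exists>G\<in>greedy_ops smul e es N. G y = P \<Gamma> y"
proof -
  define G where "G = (\<lambda>x. P (if x = y then \<Gamma> else SOME D. D \<in> greedy_sets es x N) x)"
  have "(SOME D. D \<in> greedy_sets es x N) \<in> greedy_sets es x N" for x
    by (rule someI_ex[OF ex_greedy_set])
  with assms have "G \<in> greedy_ops smul e es N"
    by (auto simp: greedy_ops_def G_def)
  moreover have "G y = P \<Gamma> y" by (simp add: G_def)
  ultimately show ?thesis by metis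
qed

section \<open>Approximation errors and admissible constants\<close>

lemma sigma_le:
  assumes "finite A" "card A \<le> N"
  shows "sigma smul e N x \<le> norm (x - lcomb a A)"
proof -
  have "lcomb a A \<in> sparse_vectors smul e N"
    using assms by (auto simp: sparse_vectors_def signed_sum_def)
  then show ?thesis unfolding sigma_def by (metis infdist_le dist_norm)
qed

lemma sigma_tilde_le:
  assumes "finite A" "card A \<le> N"
  shows "sigma_tilde smul e es N x \<le> norm (x - P A x)"
  unfolding sigma_tilde_def using assms by (intro cInf_lower bdd_belowI[of _ 0]) auto

lemma sigma_tilde_set_ne: "{norm (x - P A x) | A. finite A \<and> card A \<le> N} \<noteq> {}"
  by (auto intro!: exI[of _ "{}"])

lemma sigma_le_sigma_tilde: "sigma smul e N x \<le> sigma_tilde smul e es N x"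
  unfolding sigma_tilde_def
  by (rule cInf_greatest[OF sigma_tilde_set_ne]) (auto simp: coord_proj_eq_lcomb intro!: sigma_le)

lemma sigma_nonneg: "0 \<le> sigma smul e N x"
  by (simp add: sigma_def infdist_nonneg)

text \<open>A vector with \<open>N + 1\<close> coefficients equal to 1 cannot be exhausted by
  \<open>N\<close> indices.\<close>

lemma greedy_error_nonzero:
  assumes "G \<in> greedy_ops smul e es N"
  shows "\<exists>x. x - G x \<noteq> 0"
proof
  let ?x = "lcomb (\<lambda>_. 1) {..N}"
  obtain \<Gamma> where \<Gamma>: "\<Gamma> \<in> greedy_sets es ?x N" "G ?x = P \<Gamma> ?x"
    using assms by (auto simp: greedy_ops_def)
  have "finite \<Gamma>" "card \<Gamma> = N" using \<Gamma>(1) by (auto simp: greedy_sets_def)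
  then have "\<not> {..N} \<subseteq> \<Gamma>" by (metis card_atMost card_mono lessI not_less)
  then obtain n where "n \<le> N" "n \<notin> \<Gamma>" by auto
  then have "es n (?x - G ?x) = 1" using \<Gamma>(2) \<open>finite \<Gamma>\<close> by simp
  then show "?x - G ?x \<noteq> 0" by (metis es_simps(3) zero_neq_one)
qed

text \<open>The infima defining the Lebesgue constants range over all real \<open>C\<close>,
  negative ones included. A nonzero greedy error forces \<open>C * d x\<close> to be positive. The
  function \<open>d\<close> stands for either approximation error.\<close>

lemma admissible_nonneg:
  assumes "\<forall>x. \<forall>G\<in>greedy_ops smul e es N. norm (x - G x) \<le> C * d x" and d: "\<And>x. 0 \<le> d x"
  shows "0 \<le> C"
proof -
  obtain G where G: "G \<in> greedy_ops smul e es N"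
    using ex_greedy_set[of 0 N] ex_greedy_op by blast
  obtain x where "x - G x \<noteq> 0" using greedy_error_nonzero[OF G] by blast
  then have "0 < C * d x" using assms(1) G by (metis less_le_trans zero_less_norm_iff)
  with d[of x] show ?thesis by (simp add: zero_less_mult_iff)
qed

lemma far_blocks:
  assumes "finite A"
  shows "\<forall>\<^sub>F m in sequentially. A \<inter> {m..<m+j} = {}"
proof -
  obtain M where "\<And>n. n \<in> A \<Longrightarrow> n < M" using finite_nat_set_iff_bounded assms by auto
  then have "A \<inter> {m..<m+j} = {}" if "m \<ge> M" for m
    using that by fastforce
  then show ?thesis by (auto simp: eventually_sequentially)
qed

section \<open>The bound for complemented projections\<close>

text \<open>For a set \<open>B\<close> of exactly \<open>N\<close> indices, replacing the
  coefficients of \<open>x\<close> on \<open>B\<close> by one dominating value makes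
  \<open>B\<close> greedy without changing what remains off \<open>B\<close>. A smaller
  \<open>A\<close> is filled up to \<open>N\<close> indices by a far block, which disappears in the
  limit.\<close>

lemma norm_diff_coord_proj_le_of_lebesgue_const:
  assumes C: "\<forall>x. \<forall>G\<in>greedy_ops smul e es N. norm (x - G x) \<le> C * sigma smul e N x"
    and A: "finite A" "card A \<le> N"
  shows "norm (x - P A x) \<le> C * norm x"
proof -
  have C0: "0 \<le> C" by (rule admissible_nonneg[OF C sigma_nonneg])
  have full: "norm (x - P B x) \<le> C * norm x" if B: "finite B" "card B = N" for B
  proof -
    obtain \<alpha> where \<alpha>: "\<alpha> \<ge> 0" "\<And>n. norm (es n x) \<le> \<alpha>" using ex_coeff_upper by blast
    define y where "y = x - P B x + lcomb (\<lambda>_. of_real \<alpha>) B"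
    have es_y: "es n y = (if n \<in> B then of_real \<alpha> else es n x)" for n
      using B by (simp add: y_def)
    have "B \<in> greedy_sets es y N"
      using B \<alpha> by (auto simp: greedy_sets_def es_y)
    then obtain G where "G \<in> greedy_ops smul e es N" "G y = P B y"
      using ex_greedy_op by blast
    then have "norm (y - P B y) \<le> C * sigma smul e N y" using C by metis
    \<comment> \<open>Subtracting this combination of \<open>N\<close> basis vectors undoes the
      replacement and gives back \<open>x\<close>.\<close>
    also have "sigma smul e N y \<le> norm (y - lcomb (\<lambda>n. of_real \<alpha> - es n x) B)"
      using B by (intro sigma_le) auto
    also have "y - lcomb (\<lambda>n. of_real \<alpha> - es n x) B = x"
      by (simp add: y_def coord_proj_eq_lcomb signed_sum_def scale_left_diff_distrib sum_subtractf)
    also have "P B y = lcomb (\<lambda>_. of_real \<alpha>) B"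
      unfolding coord_proj_eq_lcomb by (rule lcomb_cong) (simp add: es_y)
    finally show ?thesis using C0 by (simp add: y_def mult_left_mono)
  qed
  let ?F = "\<lambda>m. {m..<m + (N - card A)}"
  show ?thesis
  proof (rule tendsto_upperbound)
    show "(\<lambda>m. norm (x - (P A x + P (?F m) x))) \<longlonglongrightarrow> norm (x - P A x)"
      using tendsto_norm[OF tendsto_diff[OF tendsto_const
          tendsto_add[OF tendsto_const coord_proj_block_tendsto_0]], of x "P A x" _ x]
      by simp
    show "\<forall>\<^sub>F m in sequentially. norm (x - (P A x + P (?F m) x)) \<le> C * norm x"
      using far_blocks[OF A(1), of "N - card A"]
    proof eventually_elim
      case (elim m)
      then have "card (A \<union> ?F m) = N" using A by (simp add: card_Un_disjoint)
      with elim full[of "A \<union> ?F m"] A show ?case by (simp add: coord_proj_Un)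
    qed
  qed simp
qed

text \<open>The least modulus on \<open>\<Gamma>\<close> separates it from its complement; for empty
  \<open>\<Gamma>\<close>, any upper bound of all coefficients does.\<close>

lemma greedy_threshold:
  assumes "\<Gamma> \<in> greedy_sets es w k"
  shows "\<exists>\<alpha>\<ge>0. (\<forall>m\<in>\<Gamma>. \<alpha> \<le> norm (es m w)) \<and> (\<forall>n. n \<notin> \<Gamma> \<longrightarrow> norm (es n w) \<le> \<alpha>)"
proof (cases "\<Gamma> = {}")
  case True
  then show ?thesis using ex_coeff_upper[of w] by auto
next
  case False
  then obtain m where "m \<in> \<Gamma>" "\<And>n. n \<in> \<Gamma> \<Longrightarrow> norm (es m w) \<le> norm (es n w)"
    using assms ex_is_arg_min_if_finite[of \<Gamma> "\<lambda>n. norm (es n w)"]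
    by (auto simp: greedy_sets_def is_arg_min_linorder)
  with assms show ?thesis
    by (intro exI[of _ "norm (es m w)"]) (auto simp: greedy_sets_def)
qed

section \<open>Consequences of a constant \<open>C\<close> admissible for projection errors\<close>

context
  fixes N :: nat and C :: real
  assumes C: "\<forall>x. \<forall>G\<in>greedy_ops smul e es N. norm (x - G x) \<le> C * sigma_tilde smul e es N x"
begin

lemma C_nonneg: "0 \<le> C"
  by (rule admissible_nonneg[OF C order_trans[OF sigma_nonneg sigma_le_sigma_tilde]])

lemma greedy_error_le:
  assumes \<Gamma>: "\<Gamma> \<in> greedy_sets es w k" and k: "k \<le> N" and A: "finite A" "card A \<le> k"
  shows "norm (w - P \<Gamma> w) \<le> C * norm (w - P A w)"
proof -
  have fin: "finite \<Gamma>" "card \<Gamma> = k" using \<Gamma> by (auto simp: greedy_sets_def)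
  obtain \<alpha> where \<alpha>: "\<alpha> \<ge> 0" "\<And>m. m \<in> \<Gamma> \<Longrightarrow> \<alpha> \<le> norm (es m w)" "\<And>n. n \<notin> \<Gamma> \<Longrightarrow> norm (es n w) \<le> \<alpha>"
    using greedy_threshold[OF \<Gamma>] by blast
  let ?F = "\<lambda>m. {m..<m + (N - k)}"
  \<comment> \<open>The far block must avoid \<open>A\<close> as well as \<open>\<Gamma>\<close>, so
    that the coefficients placed on it cancel in both errors.\<close>
  have finA: "finite (\<Gamma> \<union> A)" using fin A by simp
  have lim: "(\<lambda>m. norm (w - P (?F m) w - v)) \<longlonglongrightarrow> norm (w - v)" for v
    using tendsto_norm[OF tendsto_diff[OF tendsto_diff[OF tendsto_const
          coord_proj_block_tendsto_0] tendsto_const], of w "N - k" w v]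
    by simp
  show ?thesis
  proof (rule tendsto_le)
    show "(\<lambda>m. norm (w - P (?F m) w - P \<Gamma> w)) \<longlonglongrightarrow> norm (w - P \<Gamma> w)"
      by (rule lim)
    show "(\<lambda>m. C * norm (w - P (?F m) w - P A w)) \<longlonglongrightarrow> C * norm (w - P A w)"
      by (intro tendsto_mult_left lim)
    show "\<forall>\<^sub>F m in sequentially. norm (w - P (?F m) w - P \<Gamma> w) \<le> C * norm (w - P (?F m) w - P A w)"
      using far_blocks[OF finA, of "N - k"]
    proof eventually_elim
      case (elim m)
      define F where "F = ?F m"
      have F: "finite F" "card F = N - k" "\<Gamma> \<inter> F = {}" "A \<inter> F = {}"
        using elim by (auto simp: F_def)
      define y where "y = w - P F w + lcomb (\<lambda>_. of_real \<alpha>) F"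
      have es_y: "es n y = (if n \<in> F then of_real \<alpha> else es n w)" for n
        using F by (simp add: y_def)
      have P_y: "P (B \<union> F) y = P B w + lcomb (\<lambda>_. of_real \<alpha>) F" if "finite B" "B \<inter> F = {}" for B
      proof -
        have "lcomb (\<lambda>n. es n y) B = lcomb (\<lambda>n. es n w) B"
          using that by (intro lcomb_cong) (auto simp: es_y)
        moreover have "lcomb (\<lambda>n. es n y) F = lcomb (\<lambda>_. of_real \<alpha>) F"
          by (intro lcomb_cong) (auto simp: es_y)
        ultimately show ?thesis
          using that F by (simp add: coord_proj_eq_lcomb lcomb_Un)
      qed
      have "card (\<Gamma> \<union> F) = N" using fin F k by (simp add: card_Un_disjoint)
      \<comment> \<open>The value \<open>\<alpha>\<close> on \<open>F\<close> lies between the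
        coefficients on \<open>\<Gamma>\<close> and all those outside
        \<open>\<Gamma>\<close>.\<close>
      then have "\<Gamma> \<union> F \<in> greedy_sets es y N"
        using fin F \<alpha> order_trans[OF \<alpha>(3) \<alpha>(2)] by (auto simp: greedy_sets_def es_y)
      then obtain G where "G \<in> greedy_ops smul e es N" "G y = P (\<Gamma> \<union> F) y"
        using ex_greedy_op by blast
      then have "norm (y - P (\<Gamma> \<union> F) y) \<le> C * sigma_tilde smul e es N y" using C by metis
      \<comment> \<open>\<open>A \<union> F\<close> is a competitor, as it has at most
        \<open>k + (N - k) = N\<close> elements.\<close>
      also have "\<dots> \<le> C * norm (y - P (A \<union> F) y)"
        using A F k C_nonneg by (intro mult_left_mono sigma_tilde_le) (auto simp: card_Un_disjoint)
      finally have "norm (w - P F w - P \<Gamma> w) \<le> C * norm (w - P F w - P A w)"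
        using fin A F by (simp add: P_y) (simp add: y_def algebra_simps)
      then show ?case by (simp add: F_def)
    qed
  qed simp
qed

text \<open>In the sum of both signed sums and \<open>x\<close>, the set \<open>B\<close> is greedy,
  since its coefficients have modulus 1 and no coefficient exceeds 1. Removing \<open>B\<close>
  leaves the left-hand vector, removing the competitor \<open>A\<close> the right-hand one.\<close>

lemma greedy_exchange:
  assumes "finite A" "finite B" "card A \<le> card B" "card B \<le> N"
    and x: "\<And>n. norm (es n x) \<le> 1"
    and disj: "A \<inter> B = {}" "A \<inter> supp es x = {}" "B \<inter> supp es x = {}"
    and eps: "\<epsilon> \<in> unimodular" "\<eta> \<in> unimodular"
  shows "norm (lcomb \<epsilon> A + x) \<le> C * norm (lcomb \<eta> B + x)"
proof -
  define w where "w = lcomb \<epsilon> A + lcomb \<eta> B + x"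
  have es_w: "es n w = (if n \<in> A then \<epsilon> n else if n \<in> B then \<eta> n else es n x)" for n
    using assms(1,2) disj by (auto simp: w_def supp_def)
  have "B \<in> greedy_sets es w (card B)"
    using assms(2) x disj eps by (auto simp: greedy_sets_def es_w unimodular_def)
  then have "norm (w - P B w) \<le> C * norm (w - P A w)"
    using assms by (intro greedy_error_le) auto
  moreover have "P B w = lcomb \<eta> B"
    unfolding coord_proj_eq_lcomb using disj by (intro lcomb_cong) (auto simp: es_w)
  moreover have "P A w = lcomb \<epsilon> A"
    unfolding coord_proj_eq_lcomb by (intro lcomb_cong) (auto simp: es_w)
  ultimately show ?thesis by (simp add: w_def algebra_simps)
qed

text \<open>This is the exchange of \<open>B - T\<close> for \<open>D\<close>, with the retained
  part \<open>lcomb \<eta> T\<close> in the role of \<open>x\<close>.\<close>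

lemma norm_lcomb_replace_le:
  assumes "finite D" "finite B" "D \<inter> B = {}" "T \<subseteq> B" "card D \<le> card (B - T)" "card B \<le> N"
    and eps: "\<epsilon> \<in> unimodular" "\<eta> \<in> unimodular"
  shows "norm (lcomb \<epsilon> D + lcomb \<eta> T) \<le> C * norm (lcomb \<eta> B)"
proof -
  have T: "finite T" using assms finite_subset by blast
  have "card (B - T) \<le> N" using assms by (meson card_mono Diff_subset le_trans)
  then have "norm (lcomb \<epsilon> D + lcomb \<eta> T) \<le> C * norm (lcomb \<eta> (B - T) + lcomb \<eta> T)"
    using assms T by (intro greedy_exchange) (auto simp: supp_def unimodular_def)
  also have "lcomb \<eta> (B - T) + lcomb \<eta> T = lcomb \<eta> ((B - T) \<union> T)"
    using assms T by (subst lcomb_Un) auto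
  also have "(B - T) \<union> T = B" using assms by auto
  finally show ?thesis .
qed

section \<open>Bounds for the greedy, symmetry and democracy constants\<close>

lemma g_compl_le: "g_compl smul e es N \<le> ereal C"
  unfolding g_compl_def
proof (rule Sup_least, safe)
  fix x \<Gamma> k assume "\<Gamma> \<in> greedy_sets es x k" "k \<le> N"
  \<comment> \<open>With the empty competitor the right-hand error is \<open>norm x\<close>
    itself.\<close>
  then have "norm (x - P \<Gamma> x) \<le> C * norm (x - P {} x)" by (intro greedy_error_le) auto
  then show "ereal (norm (x - P \<Gamma> x) / norm x) \<le> ereal C"
    using C_nonneg by (simp add: divide_le_of_le_mult coord_proj_eq_lcomb)
qed

lemma nu_le: "nu smul e es N \<le> ereal C"
  unfolding nu_def
proof (rule Sup_least, safe)
  fix A B x and \<epsilon> \<eta> :: "nat \<Rightarrow> 'k"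
  assume "same_size_pair N A B" "\<epsilon> \<in> unimodular" "\<eta> \<in> unimodular" "coeff_sup_norm es x \<le> 1"
    "A \<inter> B = {}" "A \<inter> supp es x = {}" "B \<inter> supp es x = {}"
  then have "norm (lcomb \<epsilon> A + x) \<le> C * norm (lcomb \<eta> B + x)"
    using coeff_le_of_sup_norm_le by (intro greedy_exchange) (auto simp: same_size_pair_def)
  then show "ereal (norm (lcomb \<epsilon> A + x) / norm (lcomb \<eta> B + x)) \<le> ereal C"
    using C_nonneg by (simp add: divide_le_of_le_mult)
qed

text \<open>Only \<open>B - T\<close> is given up. It contains \<open>B - A\<close>, which has as
  many elements as \<open>A - B\<close>, so there is room for the exchange. The second bound is the
  exchange with nothing inserted.\<close>

lemma norm_diff_inter_le:
  assumes AB: "same_size_pair N A B" and T: "T \<subseteq> A \<inter> B"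
    and eps: "\<epsilon> \<in> unimodular" "\<eta> \<in> unimodular"
  shows "norm (lcomb \<epsilon> (A - B) + lcomb \<eta> T) \<le> C * norm (lcomb \<eta> B)"
    and "norm (lcomb \<eta> T) \<le> C * norm (lcomb \<eta> B)"
proof -
  have fin: "finite A" "finite B" "card B \<le> N" using AB by (auto simp: same_size_pair_def)
  have "card (B - A) \<le> card (B - T)" using T fin by (intro card_mono) auto
  then have *: "card (A - B) \<le> card (B - T)" using card_Diff_eq_of_same_size[OF AB] by simp
  show "norm (lcomb \<epsilon> (A - B) + lcomb \<eta> T) \<le> C * norm (lcomb \<eta> B)"
    using fin T eps * by (intro norm_lcomb_replace_le) auto
  show "norm (lcomb \<eta> T) \<le> C * norm (lcomb \<eta> B)"
    using norm_lcomb_replace_le[of "{}" B T \<eta> \<eta>] fin T eps by auto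
qed

lemma mu_le: "mu e N \<le> ereal C"
  unfolding mu_def
proof (rule Sup_least, safe)
  fix A B assume AB: "same_size_pair N A B"
  have "norm (ind_sum e A) \<le> C * norm (ind_sum e B)"
    \<comment> \<open>All signs are 1 here, and \<open>T\<close> is the whole of
      \<open>A \<inter> B\<close>.\<close>
    unfolding ind_sum_eq_lcomb lcomb_split[OF AB]
    by (rule norm_diff_inter_le[OF AB]) (auto simp: unimodular_def)
  then show "ereal (norm (ind_sum e A) / norm (ind_sum e B)) \<le> ereal C"
    using C_nonneg by (simp add: divide_le_of_le_mult)
qed

section \<open>Unimodular signs\<close>

text \<open>The positive and negative parts of \<open>a\<close> have values in
  \<open>[0, 1]\<close>, so convexity reduces each to subset sums, at cost \<open>C\<close> apiece.
  The sum over \<open>A - B\<close> travels with the positive part and adds no further cost.\<close>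

lemma norm_real_comb_le:
  assumes AB: "same_size_pair N A B" and eps: "\<epsilon> \<in> unimodular" "\<eta> \<in> unimodular"
    and a: "\<And>n. \<bar>a n\<bar> \<le> 1"
  shows "norm (lcomb \<epsilon> (A - B) + (\<Sum>n\<in>A \<inter> B. a n *\<^sub>R smul (\<eta> n) (e n))) \<le> 2 * C * norm (lcomb \<eta> B)"
    and "norm (\<Sum>n\<in>A \<inter> B. a n *\<^sub>R smul (\<eta> n) (e n)) \<le> 2 * C * norm (lcomb \<eta> B)"
proof -
  let ?u = "\<lambda>n. smul (\<eta> n) (e n)"
  let ?S = "\<lambda>a. \<Sum>n\<in>A \<inter> B. a n *\<^sub>R ?u n"
  let ?M = "C * norm (lcomb \<eta> B)"
  have fin: "finite (A \<inter> B)" using AB by (auto simp: same_size_pair_def)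
  have 1: "norm (lcomb \<epsilon> (A - B) + ?S b) \<le> ?M" if "\<And>n. 0 \<le> b n \<and> b n \<le> 1" for b
    using norm_diff_inter_le(1)[OF AB _ eps] fin that
    by (intro norm_add_sum_scaled_le) (auto simp: signed_sum_def)
  have 2: "norm (?S b) \<le> ?M" if "\<And>n. 0 \<le> b n \<and> b n \<le> 1" for b
    using norm_diff_inter_le(2)[OF AB _ eps] fin that norm_add_sum_scaled_le[of "A \<inter> B" b 0 ?u ?M]
    by (auto simp: signed_sum_def)
  have S: "?S a = ?S (\<lambda>n. max (a n) 0) - ?S (\<lambda>n. max (- a n) 0)"
    unfolding sum_subtractf[symmetric] scaleR_left_diff_distrib[symmetric]
    by (intro sum.cong arg_cong[of _ _ "\<lambda>r. r *\<^sub>R _"]) auto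
  have b: "0 \<le> max (a n) 0 \<and> max (a n) 0 \<le> 1" "0 \<le> max (- a n) 0 \<and> max (- a n) 0 \<le> 1" for n
    using a[of n] by auto
  have "norm (lcomb \<epsilon> (A - B) + ?S a) \<le> ?M + ?M"
    unfolding S add_diff_eq by (intro order_trans[OF norm_triangle_ineq4 add_mono] 1 2 b)
  then show "norm (lcomb \<epsilon> (A - B) + ?S a) \<le> 2 * C * norm (lcomb \<eta> B)" by simp
  have "norm (?S a) \<le> ?M + ?M"
    unfolding S by (intro order_trans[OF norm_triangle_ineq4 add_mono] 2 b)
  then show "norm (?S a) \<le> 2 * C * norm (lcomb \<eta> B)" by simp
qed

lemma mu_tilde_leI:
  assumes "\<kappa> > 0"
    and "\<And>A B \<epsilon> \<eta>. same_size_pair N A B \<Longrightarrow> \<epsilon> \<in> unimodular \<Longrightarrow> \<eta> \<in> unimodular \<Longrightarrow>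
      norm (lcomb \<epsilon> A) \<le> 2 * \<kappa> * C * norm (lcomb \<eta> B)"
  shows "ereal (1 / (2 * \<kappa>)) * mu_tilde smul e N \<le> ereal C"
proof -
  have "mu_tilde smul e N \<le> ereal (2 * \<kappa> * C)"
    unfolding mu_tilde_def using assms C_nonneg by (intro Sup_least) (auto intro!: divide_le_of_le_mult)
  then have "ereal (1 / (2 * \<kappa>)) * mu_tilde smul e N \<le> ereal (1 / (2 * \<kappa>)) * ereal (2 * \<kappa> * C)"
    using assms(1) by (intro ereal_mult_left_mono) auto
  then show ?thesis using assms(1) by simp
qed

end

section \<open>Lower bounds for both Lebesgue constants\<close>

lemma lebesgue_const_ge:
  "max (k_compl smul e es N) (lebesgue_const_tilde smul e es N) \<le> lebesgue_const smul e es N"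
  unfolding lebesgue_const_def
proof (rule Inf_greatest, safe)
  fix C assume C: "\<forall>x. \<forall>G\<in>greedy_ops smul e es N. norm (x - G x) \<le> C * sigma smul e N x"
  have C0: "0 \<le> C" by (rule admissible_nonneg[OF C sigma_nonneg])
  have "k_compl smul e es N \<le> ereal C"
    unfolding k_compl_def using norm_diff_coord_proj_le_of_lebesgue_const[OF C] C0
    by (intro Sup_least) (auto intro!: onorm_bound)
  \<comment> \<open>Since \<open>sigma\<close> is at most \<open>sigma_tilde\<close> and
    \<open>C\<close> is nonnegative, \<open>C\<close> is admissible for the projection errors
    too.\<close>
  moreover have "lebesgue_const_tilde smul e es N \<le> ereal C"
    unfolding lebesgue_const_tilde_def
    using C order_trans[OF _ mult_left_mono[OF sigma_le_sigma_tilde C0]]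
    by (intro Inf_lower) blast
  ultimately show "max (k_compl smul e es N) (lebesgue_const_tilde smul e es N) \<le> ereal C"
    by simp
qed

text \<open>The sign estimate, where the scalar field enters, is taken as a hypothesis, so that the
  real and complex cases share the rest.\<close>

lemma lebesgue_const_tilde_ge:
  assumes "\<kappa> > 0"
    and "\<And>C A B \<epsilon> \<eta>. \<forall>x. \<forall>G\<in>greedy_ops smul e es N. norm (x - G x) \<le> C * sigma_tilde smul e es N x \<Longrightarrow>
      same_size_pair N A B \<Longrightarrow> \<epsilon> \<in> unimodular \<Longrightarrow> \<eta> \<in> unimodular \<Longrightarrow>
      norm (lcomb \<epsilon> A) \<le> 2 * \<kappa> * C * norm (lcomb \<eta> B)"
  shows "Max {g_compl smul e es N, nu smul e es N, mu e N,
      ereal (1 / (2 * \<kappa>)) * mu_tilde smul e N} \<le> lebesgue_const_tilde smul e es N"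
  unfolding lebesgue_const_tilde_def
proof (rule Inf_greatest, safe)
  fix C assume C: "\<forall>x. \<forall>G\<in>greedy_ops smul e es N. norm (x - G x) \<le> C * sigma_tilde smul e es N x"
  show "Max {g_compl smul e es N, nu smul e es N, mu e N,
      ereal (1 / (2 * \<kappa>)) * mu_tilde smul e N} \<le> ereal C"
    using g_compl_le[OF C] nu_le[OF C] mu_le[OF C] mu_tilde_leI[OF C assms(1) assms(2)[OF C]]
    by simp
qed

end

section \<open>Sign estimates over the two scalar fields\<close>

text \<open>On \<open>A \<inter> B\<close> the quotient \<open>\<epsilon> n / \<eta> n\<close> is
  real of modulus 1, so a single application of the real-coefficient bound suffices.\<close>

lemma norm_signed_sum_le_real:
  fixes e :: "nat \<Rightarrow> 'a::banach" and es :: "nat \<Rightarrow> 'a \<Rightarrow> real"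
  assumes "seminormalized_biorthogonal_system scaleR e es"
    and C: "\<forall>x. \<forall>G\<in>greedy_ops scaleR e es N. norm (x - G x) \<le> C * sigma_tilde scaleR e es N x"
    and AB: "same_size_pair N A B" and eps: "\<epsilon> \<in> unimodular" "\<eta> \<in> unimodular"
  shows "norm (signed_sum scaleR e \<epsilon> A) \<le> 2 * C * norm (signed_sum scaleR e \<eta> B)"
proof -
  interpret seminormalized_biorthogonal_system scaleR e es by fact
  have un: "\<bar>\<epsilon> n\<bar> = 1" "\<bar>\<eta> n\<bar> = 1" for n using eps by (auto simp: unimodular_def)
  have "lcomb \<epsilon> (A \<inter> B) = (\<Sum>n\<in>A \<inter> B. (\<epsilon> n / \<eta> n) *\<^sub>R \<eta> n *\<^sub>R e n)"
    unfolding signed_sum_def using un(2) by (intro sum.cong) (auto, metis abs_zero zero_neq_one)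
  then show ?thesis
    using norm_real_comb_le(1)[OF C AB eps, of "\<lambda>n. \<epsilon> n / \<eta> n"] un
    by (simp add: lcomb_split[OF AB] abs_divide)
qed

text \<open>The real and imaginary parts of \<open>\<epsilon> n / \<eta> n\<close> each cost
  \<open>2 * C\<close>. The sum over \<open>A - B\<close> is attached to the real part only, and
  multiplication by \<open>\<i>\<close> preserves the norm of the other.\<close>

lemma norm_signed_sum_le_complex:
  fixes smul :: "complex \<Rightarrow> 'a::banach \<Rightarrow> 'a"
  assumes "seminormalized_biorthogonal_system smul e es"
    and C: "\<forall>x. \<forall>G\<in>greedy_ops smul e es N. norm (x - G x) \<le> C * sigma_tilde smul e es N x"
    and AB: "same_size_pair N A B" and eps: "\<epsilon> \<in> unimodular" "\<eta> \<in> unimodular"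
  shows "norm (signed_sum smul e \<epsilon> A) \<le> 4 * C * norm (signed_sum smul e \<eta> B)"
proof -
  interpret seminormalized_biorthogonal_system smul e es by fact
  define \<theta> where "\<theta> n = \<epsilon> n / \<eta> n" for n
  have un: "norm (\<epsilon> n) = 1" "norm (\<eta> n) = 1" for n using eps by (auto simp: unimodular_def)
  then have "norm (\<theta> n) = 1" for n by (simp add: \<theta>_def norm_divide)
  then have \<theta>: "\<bar>Re (\<theta> n)\<bar> \<le> 1" "\<bar>Im (\<theta> n)\<bar> \<le> 1" for n using abs_Re_le_cmod abs_Im_le_cmod by metis+
  let ?S = "\<lambda>a. \<Sum>n\<in>A \<inter> B. a n *\<^sub>R smul (\<eta> n) (e n)"
  have "smul (\<epsilon> n) (e n) = Re (\<theta> n) *\<^sub>R smul (\<eta> n) (e n) + smul \<i> (Im (\<theta> n) *\<^sub>R smul (\<eta> n) (e n))" for n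
  proof -
    have "\<eta> n \<noteq> 0" using un(2)[of n] by auto
    then have "\<epsilon> n = (of_real (Re (\<theta> n)) + \<i> * of_real (Im (\<theta> n))) * \<eta> n"
      unfolding complex_eq[symmetric] by (simp add: \<theta>_def)
    then show ?thesis
      by (simp flip: scale_of_real add: scale_left_distrib distrib_right mult.assoc)
  qed
  then have "lcomb \<epsilon> (A \<inter> B) = ?S (\<lambda>n. Re (\<theta> n)) + smul \<i> (?S (\<lambda>n. Im (\<theta> n)))"
    by (simp add: signed_sum_def sum.distrib scale_sum_right)
  then have "lcomb \<epsilon> A = (lcomb \<epsilon> (A - B) + ?S (\<lambda>n. Re (\<theta> n))) + smul \<i> (?S (\<lambda>n. Im (\<theta> n)))"
    by (simp add: lcomb_split[OF AB])
  also have "norm \<dots> \<le> norm (lcomb \<epsilon> (A - B) + ?S (\<lambda>n. Re (\<theta> n))) + norm (?S (\<lambda>n. Im (\<theta> n)))"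
    by (rule order_trans[OF norm_triangle_ineq]) (simp add: norm_scale)
  also have "\<dots> \<le> 2 * C * norm (lcomb \<eta> B) + 2 * C * norm (lcomb \<eta> B)"
    by (intro add_mono norm_real_comb_le[OF C AB eps] \<theta>)
  finally show ?thesis by simp
qed

theorem proposition1p3:
  fixes N :: nat
  assumes "N \<ge> 1"
  shows
    "(\<forall>(e :: nat \<Rightarrow> 'a::banach) (es :: nat \<Rightarrow> 'a \<Rightarrow> real) \<kappa>::real.
        seminormalized_biorthogonal_system scaleR e es \<and> \<kappa> = 1 \<longrightarrow>
          lebesgue_const scaleR e es N
            \<ge> max (k_compl scaleR e es N) (lebesgue_const_tilde scaleR e es N) \<and>
          lebesgue_const_tilde scaleR e es N
            \<ge> Max {g_compl scaleR e es N, nu scaleR e es N, mu e N,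
                    ereal (1 / (2 * \<kappa>)) * mu_tilde scaleR e N})
     \<and>
     (\<forall>(smul :: complex \<Rightarrow> 'b::banach \<Rightarrow> 'b) (e :: nat \<Rightarrow> 'b) (es :: nat \<Rightarrow> 'b \<Rightarrow> complex) \<kappa>::real.
        seminormalized_biorthogonal_system smul e es \<and> \<kappa> = 2 \<longrightarrow>
          lebesgue_const smul e es N
            \<ge> max (k_compl smul e es N) (lebesgue_const_tilde smul e es N) \<and>
          lebesgue_const_tilde smul e es N
            \<ge> Max {g_compl smul e es N, nu smul e es N, mu e N,
                    ereal (1 / (2 * \<kappa>)) * mu_tilde smul e N})"
proof (intro conjI[where P = "All _"] allI impI; elim conjE)
  fix e :: "nat \<Rightarrow> 'a" and es :: "nat \<Rightarrow> 'a \<Rightarrow> real" and \<kappa> :: real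
  assume sys: "seminormalized_biorthogonal_system scaleR e es" and \<kappa>: "\<kappa> = 1"
  interpret seminormalized_biorthogonal_system scaleR e es by (rule sys)
  show "lebesgue_const scaleR e es N
            \<ge> max (k_compl scaleR e es N) (lebesgue_const_tilde scaleR e es N) \<and>
          lebesgue_const_tilde scaleR e es N
            \<ge> Max {g_compl scaleR e es N, nu scaleR e es N, mu e N,
                    ereal (1 / (2 * \<kappa>)) * mu_tilde scaleR e N}"
    using lebesgue_const_ge norm_signed_sum_le_real[OF sys]
    by (intro conjI lebesgue_const_tilde_ge) (auto simp: \<kappa>)
next
  fix smul :: "complex \<Rightarrow> 'b \<Rightarrow> 'b" and e :: "nat \<Rightarrow> 'b" and es :: "nat \<Rightarrow> 'b \<Rightarrow> complex" and \<kappa> :: real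
  assume sys: "seminormalized_biorthogonal_system smul e es" and \<kappa>: "\<kappa> = 2"
  interpret seminormalized_biorthogonal_system smul e es by (rule sys)
  show "lebesgue_const smul e es N
            \<ge> max (k_compl smul e es N) (lebesgue_const_tilde smul e es N) \<and>
          lebesgue_const_tilde smul e es N
            \<ge> Max {g_compl smul e es N, nu smul e es N, mu e N,
                    ereal (1 / (2 * \<kappa>)) * mu_tilde smul e N}"
    using lebesgue_const_ge norm_signed_sum_le_complex[OF sys]
    by (intro conjI lebesgue_const_tilde_ge) (auto simp: \<kappa>)
qed

end
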